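(* Consider the event-triggered decentralized algorithm described in the context, with data $n$, $\mathcal G$, $f_i$, $g_i$, $\beta$, $H$, $E_{i,k}$. Assume: (1) the graph $\mathcal G$ is fixed and connected; (2) the sequence $E_k=\max_{1\le i\le n}E_{i,k}$, $k\in\mathbb N$, is non-increasing and $\sum_{k=0}^\infty E_k<\infty$; (3) each $f_i:\mathbb R\to\mathbb R$ is convex and differentiable with $|\nabla f_i(x)-\nabla f_i(y)|\le l_{f_i}|x-y|$ for all $x,y\in\mathbb R$, where $l_{f_i}>0$. Put $L_f=\mathrm{diag}(l_{f_1},\dots,l_{f_n})$ and $P=H-\beta\mathcal L$, and assume $P-L_f\succ 0$. Let $(x^*,y^* )$ be an optimal primal-dual pair and $z^*=\sqrt{\mathcal L}y^*$. For $t\ge1$ let $$a=\max\{2\beta\overline\lambda(\mathcal L),1\},\qquad b=\min\Big\{\underline\lambda(L_f),\frac{1}{\overline\lambda(\beta\mathcal L+\frac{\mathbf 1\mathbf 1^{\mathrm T}}{n})}\Big\},\qquad A_t=\frac{2a\sqrt n}{b}\sum_{k=1}^tE_{k-1}.$$ Then for every $t\ge1$ and every $k\le t$, $$\|x_k-x^*\|+\|z^*-z_k\|\le 2A_t+\sqrt{\frac2b}\Big(\|x_0-x^*\|_P+\|z_0-z^*\|_{(\beta\mathcal L+\frac{\mathbf 1\mathbf 1^{\mathrm T}}{n})^{-1}}\Big).$$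
   Context: Notation. $\mathbf 1\in\mathbb R^n$ is the all-ones column vector. For a symmetric matrix $W$, $\overline\lambda(W)$ and $\underline\lambda(W)$ are its largest and smallest eigenvalues; $W\succ0$ ($\succeq0$) means positive (semi)definite. $\|\cdot\|$ is the Euclidean norm; $\|x\|_W=\sqrt{x^{\mathrm T}Wx}$. Graph. $\mathcal G=(\mathcal V,\mathcal E)$ is a simple undirected graph on $\mathcal V=\{1,\dots,n\}$, $\mathcal N_i$ is the set of neighbors of $i$, and $\mathcal L=\mathcal D-\mathcal A$ is the graph Laplacian ($\mathcal A$ the 0/1 adjacency matrix, $\mathcal D$ the diagonal degree matrix). $\mathcal L\succeq 0$ and $\sqrt{\mathcal L}$ is its positive semidefinite square root. Problem. The decision variable is scalar ($m=1$). $F_i=f_i+g_i$, with $f_i:\mathbb R\to\mathbb R$ smooth convex and $g_i:\mathbb R\to\mathbb R\cup\{+\infty\}$ proper, lower semicontinuous, convex, possibly non-differentiable. For $x=(x_1,\dots,x_n)^{\mathrm T}\in\mathbb R^n$ put $f(x)=\sum_i f_i(x_i)$, $g(x)=\sum_i g_i(x_i)$, $F(x)=f(x)+g(x)$. The problem is $\min_{x\in\mathbb R^n}F(x)$ subject to $\sqrt{\mathcal L}x=0$. An optimal primal-dual pair is a pair $(x^*,y^* )\in\mathbb R^n\times\mathbb R^n$ with $0\in\partial F(x^* )+\sqrt{\mathcal L}y^*$ and $\sqrt{\mathcal L}x^*=0$ ($\partial F$ is the convex subdifferential). Algorithm. Parameters: $\beta>0$, a diagonal matrix $H=\mathrm{diag}(\eta_1,\dots,\eta_n)\succ0$,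 and thresholds $E_{i,k}\ge0$ ($1\le i\le n$, $k\in\mathbb N=\{0,1,2,\dots\}$). Start from any $x_0=(x_{1,0},\dots,x_{n,0})^{\mathrm T}\in\mathbb R^n$, with $z_{i,0}=0$ and $\tilde x_{i,0}=x_{i,0}$ for all $i$. For $k=0,1,2,\dots$ and each $i$: $$x_{i,k+1}=\arg\min_{x\in\mathbb R}\Big\{g_i(x)+\frac{\eta_i}{2}(x-x_{i,k})^2+\Big(\nabla f_i(x_{i,k})+z_{i,k}+\beta\sum_{j\in\mathcal N_i}(\tilde x_{i,k}-\tilde x_{j,k})\Big)x\Big\},$$ then $\tilde x_{i,k+1}=x_{i,k+1}$ if $|x_{i,k+1}-\tilde x_{i,k}|>E_{i,k+1}$ and $\tilde x_{i,k+1}=\tilde x_{i,k}$ otherwise, and then $$z_{i,k+1}=z_{i,k}+\beta\sum_{j\in\mathcal N_i}(\tilde x_{i,k+1}-\tilde x_{j,k+1}).$$ Write $x_k=(x_{1,k},\dots,x_{n,k})^{\mathrm T}$ and $z_k=(z_{1,k},\dots,z_{n,k})^{\mathrm T}$. *)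

theory Defs
  imports "HOL-Analysis.Analysis"
begin

(* A finite type 'n plays the role of the index set {1,...,n}, with n = CARD('n). *)

section \<open>Matrices\<close>

definition diag_matrix :: "real ^ 'n \<Rightarrow> real ^ 'n ^ 'n" where
  "diag_matrix d = (\<chi> i j. if i = j then d $ i else 0)"

definition pos_def :: "real ^ 'n ^ 'n \<Rightarrow> bool" where
  "pos_def W \<longleftrightarrow> transpose W = W \<and> (\<forall>v. v \<noteq> 0 \<longrightarrow> 0 < v \<bullet> (W *v v))"

definition pos_semidef :: "real ^ 'n ^ 'n \<Rightarrow> bool" where
  "pos_semidef W \<longleftrightarrow> transpose W = W \<and> (\<forall>v. 0 \<le> v \<bullet> (W *v v))"

definition eigenvalues :: "real ^ 'n ^ 'n \<Rightarrow> real set" where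
  "eigenvalues W = {c. \<exists>v. v \<noteq> 0 \<and> W *v v = c *\<^sub>R v}"

(* Used for symmetric W only, whose set of real eigenvalues is finite and nonempty. *)
definition lambda_max :: "real ^ 'n ^ 'n \<Rightarrow> real" where
  "lambda_max W = Max (eigenvalues W)"

definition lambda_min :: "real ^ 'n ^ 'n \<Rightarrow> real" where
  "lambda_min W = Min (eigenvalues W)"

(* Well defined for positive semidefinite W, which has exactly one such square root. *)
definition psd_sqrt :: "real ^ 'n ^ 'n \<Rightarrow> real ^ 'n ^ 'n" where
  "psd_sqrt W = (THE S. pos_semidef S \<and> S ** S = W)"

definition wnorm :: "real ^ 'n ^ 'n \<Rightarrow> real ^ 'n \<Rightarrow> real" where
  "wnorm W v = sqrt (v \<bullet> (W *v v))"

(* The averaging matrix (1 1^T) / n. *)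
definition avg_matrix :: "real ^ 'n ^ 'n" where
  "avg_matrix = (\<chi> i j. 1 / real CARD('n))"


section \<open>Graphs\<close>

(* A simple undirected graph on 'n is given by its symmetric, irreflexive adjacency relation. *)
definition simple_graph :: "('n \<times> 'n) set \<Rightarrow> bool" where
  "simple_graph G \<longleftrightarrow> sym G \<and> irrefl G"

definition connected_graph :: "('n \<times> 'n) set \<Rightarrow> bool" where
  "connected_graph G \<longleftrightarrow> (\<forall>i j. (i, j) \<in> G\<^sup>*)"

definition neighbors :: "('n \<times> 'n) set \<Rightarrow> 'n \<Rightarrow> 'n set" where
  "neighbors G i = {j. (i, j) \<in> G}"

definition adjacency_matrix :: "('n \<times> 'n) set \<Rightarrow> real ^ 'n ^ 'n" where
  "adjacency_matrix G = (\<chi> i j. if (i, j) \<in> G then 1 else 0)"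

definition degree_matrix :: "('n \<times> 'n) set \<Rightarrow> real ^ 'n ^ 'n" where
  "degree_matrix G = diag_matrix (\<chi> i. real (card (neighbors G i)))"

definition laplacian :: "('n \<times> 'n) set \<Rightarrow> real ^ 'n ^ 'n" where
  "laplacian G = degree_matrix G - adjacency_matrix G"


section \<open>Extended-real-valued convex functions\<close>

definition proper :: "('a \<Rightarrow> ereal) \<Rightarrow> bool" where
  "proper h \<longleftrightarrow> (\<forall>x. h x \<noteq> -\<infinity>) \<and> (\<exists>x. h x \<noteq> \<infinity>)"

definition lower_semicont :: "('a::topological_space \<Rightarrow> ereal) \<Rightarrow> bool" where
  "lower_semicont h \<longleftrightarrow> (\<forall>x. h x \<le> Liminf (at x) h)"

definition ereal_convex :: "('a::real_vector \<Rightarrow> ereal) \<Rightarrow> bool" where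
  "ereal_convex h \<longleftrightarrow>
    (\<forall>x y. \<forall>t\<in>{0..1}. h ((1 - t) *\<^sub>R x + t *\<^sub>R y) \<le> ereal (1 - t) * h x + ereal t * h y)"

(* Empty outside the effective domain. *)
definition subdifferential :: "('a::real_inner \<Rightarrow> ereal) \<Rightarrow> 'a \<Rightarrow> 'a set" where
  "subdifferential h x = {v. \<bar>h x\<bar> \<noteq> \<infinity> \<and> (\<forall>y. h x + ereal (v \<bullet> (y - x)) \<le> h y)}"


section \<open>The problem and the algorithm\<close>

definition objective :: "('n \<Rightarrow> real \<Rightarrow> real) \<Rightarrow> ('n \<Rightarrow> real \<Rightarrow> ereal) \<Rightarrow> real ^ 'n \<Rightarrow> ereal" where
  "objective f g x = ereal (\<Sum>i\<in>UNIV. f i (x $ i)) + (\<Sum>i\<in>UNIV. g i (x $ i))"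

definition optimal_pair ::
  "('n \<times> 'n) set \<Rightarrow> ('n \<Rightarrow> real \<Rightarrow> real) \<Rightarrow> ('n \<Rightarrow> real \<Rightarrow> ereal) \<Rightarrow> real ^ 'n \<Rightarrow> real ^ 'n \<Rightarrow> bool"
where
  "optimal_pair G f g x y \<longleftrightarrow>
    0 \<in> (\<lambda>v. v + psd_sqrt (laplacian G) *v y) ` subdifferential (objective f g) x \<and>
    psd_sqrt (laplacian G) *v x = 0"

(* x, xt, z are the sequences x_k, x~_k, z_k produced by the algorithm from the starting
   point x 0, which is arbitrary. The objective of the arg min is strongly convex, so
   is_arg_min determines x (Suc k) uniquely. *)
definition event_triggered_run ::
  "('n \<times> 'n) set \<Rightarrow> ('n \<Rightarrow> real \<Rightarrow> real) \<Rightarrow> ('n \<Rightarrow> real \<Rightarrow> ereal) \<Rightarrow> real \<Rightarrow> real ^ 'n \<Rightarrow>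
   ('n \<Rightarrow> nat \<Rightarrow> real) \<Rightarrow> (nat \<Rightarrow> real ^ 'n) \<Rightarrow> (nat \<Rightarrow> real ^ 'n) \<Rightarrow> (nat \<Rightarrow> real ^ 'n) \<Rightarrow> bool"
where
  "event_triggered_run G f g \<beta> \<eta> E x xt z \<longleftrightarrow>
    z 0 = 0 \<and> xt 0 = x 0 \<and>
    (\<forall>k i.
      is_arg_min
        (\<lambda>u. g i u + ereal (\<eta> $ i / 2 * (u - x k $ i)\<^sup>2
              + (deriv (f i) (x k $ i) + z k $ i
                 + \<beta> * (\<Sum>j\<in>neighbors G i. xt k $ i - xt k $ j)) * u))
        (\<lambda>_. True) (x (Suc k) $ i) \<and>
      xt (Suc k) $ i =
        (if \<bar>x (Suc k) $ i - xt k $ i\<bar> > E i (Suc k) then x (Suc k) $ i else xt k $ i) \<and>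
      z (Suc k) $ i =
        z k $ i + \<beta> * (\<Sum>j\<in>neighbors G i. xt (Suc k) $ i - xt (Suc k) $ j))"

end

theory Submission
  imports Defs
begin

text \<open>
  Write \<open>\<xi>\<^sub>k\<close> for the triggering error, the difference between the broadcast and the true state; its
  norm is at most \<open>\<surd>n E\<^sub>k\<close>. With \<open>W = \<beta> L + 1 1\<^sup>T / n\<close>, the energy
  \<open>V\<^sub>k = \<parallel>x\<^sub>k - x\<^sup>*\<parallel>\<^sub>P\<^sup>2 + \<parallel>z\<^sub>k - z\<^sup>*\<parallel>\<^sup>2\<close> (second norm weighted by \<open>W\<^sup>-\<^sup>1\<close>) decreases up to a term caused by
  the errors: monotonicity of the subdifferentials of the \<open>g\<^sub>i\<close>, the descent lemma for the \<open>f\<^sub>i\<close> and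
  \<open>P \<succeq> L\<^sub>f\<close> give \<open>V\<^sub>k\<^sub>+\<^sub>1 \<le> V\<^sub>k + 2 a \<surd>n E\<^sub>k s\<^sub>k\<^sub>+\<^sub>1\<close>, where
  \<open>s\<^sub>k = \<parallel>x\<^sub>k - x\<^sup>*\<parallel> + \<parallel>z\<^sub>k - z\<^sup>*\<parallel>\<close>. Here \<open>z\<^sub>k - z\<^sup>*\<close> is orthogonal to the vector 1, on whose
  complement \<open>W\<close> inverts to a pseudoinverse of \<open>\<beta> L\<close>. Since \<open>b s\<^sub>k\<^sup>2 / 2 \<le> V\<^sub>k\<close>, the maximum of
  \<open>s\<^sub>k\<close> over \<open>k \<le> t\<close> satisfies a quadratic inequality, which yields the bound.
\<close>

section \<open>Symmetric matrices\<close>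

lemma inner_matrix_symmetric:
  fixes W :: "real ^ 'n ^ 'n"
  assumes "transpose W = W"
  shows "u \<bullet> (W *v v) = (W *v u) \<bullet> v"
  by (metis assms dot_lmul_matrix transpose_matrix_vector)

lemma symmetric_matrixI:
  fixes W :: "real ^ 'n ^ 'n"
  assumes "\<And>u v. u \<bullet> (W *v v) = (W *v u) \<bullet> v"
  shows "transpose W = W"
proof -
  have "\<forall>v. (transpose W *v u) \<bullet> v = (W *v u) \<bullet> v" for u
    by (simp only: transpose_matrix_vector dot_lmul_matrix assms) simp
  then have "transpose W *v u = W *v u" for u
    by (simp only: vector_eq_rdot)
  then show ?thesis
    by (simp only: matrix_eq) simp
qed

text \<open>For small t the linear term dominates, so it must vanish. This replaces differentiation
  when a quadratic form is perturbed at a maximizer.\<close>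

lemma nonneg_quadratic_imp_linear_zero:
  fixes p q :: real
  assumes "\<And>t. 0 \<le> p * t + q * t\<^sup>2"
  shows "p = 0"
proof (rule ccontr)
  assume "p \<noteq> 0"
  \<comment> \<open>The sign of \<open>t\<close> opposes \<open>p\<close>. The summand 1 avoids
    division by zero and leaves the surplus \<open>- t\<^sup>2\<close>, which gives the
    contradiction.\<close>
  define t where "t = - p / (\<bar>q\<bar> + 1)"
  have "p * t + q * t\<^sup>2 \<le> p * t + (\<bar>q\<bar> + 1) * t\<^sup>2 - t\<^sup>2"
    using mult_right_mono[of q "\<bar>q\<bar>" "t\<^sup>2"] by (simp add: algebra_simps)
  also have "p * t + (\<bar>q\<bar> + 1) * t\<^sup>2 = 0"
    by (simp add: t_def power2_eq_square divide_simps)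
  finally have "t\<^sup>2 \<le> 0"
    using assms[of t] by linarith
  then show False
    using \<open>p \<noteq> 0\<close> by (simp add: t_def)
qed

text \<open>A maximizer of the quadratic form on the unit sphere of an invariant subspace is an
  eigenvector. The version on subspaces allows an eigenbasis to be extended within an orthogonal
  complement.\<close>

lemma symmetric_Rayleigh_on_subspace:
  fixes W :: "real ^ 'n ^ 'n"
  assumes sym: "transpose W = W" and S: "subspace S" "S \<noteq> {0}"
    and inv: "\<And>u. u \<in> S \<Longrightarrow> W *v u \<in> S"
  obtains v c where "v \<in> S" "norm v = 1" "W *v v = c *\<^sub>R v"
    "\<And>u. u \<in> S \<Longrightarrow> u \<bullet> (W *v u) \<le> c * (u \<bullet> u)"
proof -
  let ?q = "\<lambda>u. u \<bullet> (W *v u)"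
  obtain s where s: "s \<in> S" "s \<noteq> 0"
    using S subspace_0 by blast
  let ?K = "S \<inter> sphere 0 1"
  have "compact ?K"
    using closed_subspace[OF S(1)] by (intro closed_Int_compact) auto
  moreover have "s /\<^sub>R norm s \<in> ?K"
    using s S(1) by (simp add: subspace_scale)
  moreover have "continuous_on ?K ?q"
    by (intro continuous_on_inner continuous_on_id linear_continuous_on
        matrix_vector_mul_bounded_linear)
  ultimately obtain v where v: "v \<in> ?K" "\<And>u. u \<in> ?K \<Longrightarrow> ?q u \<le> ?q v"
    using continuous_attains_sup[of ?K ?q] by blast
  define c where "c = ?q v"
  have bound: "?q u \<le> c * (u \<bullet> u)" if u: "u \<in> S" for u
  proof (cases "u = 0")
    case False
    then have "u /\<^sub>R norm u \<in> ?K"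
      using u S(1) by (simp add: subspace_scale)
    from v(2)[OF this] have "?q (u /\<^sub>R norm u) \<le> c"
      by (simp add: c_def)
    moreover have "?q (r *\<^sub>R u) = r\<^sup>2 * ?q u" for r
      by (simp only: matrix_vector_mult_scaleR) (simp add: power2_eq_square)
    ultimately have "?q u / (norm u)\<^sup>2 \<le> c"
      by (metis divide_inverse mult.commute power_inverse)
    then show ?thesis
      using False by (simp add: divide_le_eq power2_norm_eq_inner)
  qed simp
  have vS: "v \<in> S" and nv: "norm v = 1"
    using v(1) by auto
  have vv: "v \<bullet> v = 1"
    using nv by (simp add: norm_eq_1)
  \<comment> \<open>The residual lies in \<open>S\<close> by invariance. Perturbing \<open>v\<close>
    along it turns \<open>bound\<close> into a nonnegative quadratic in t without constant term,
    whose linear coefficient is twice the squared norm of the residual.\<close>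
  let ?d = "c *\<^sub>R v - W *v v"
  have dS: "?d \<in> S"
    using vS inv S(1) by (simp add: subspace_diff subspace_scale)
  have "2 * (?d \<bullet> ?d) = 0"
  proof (rule nonneg_quadratic_imp_linear_zero)
    fix t
    let ?u = "v + t *\<^sub>R ?d"
    have "?u \<in> S"
      using vS dS S(1) by (simp add: subspace_add subspace_scale)
    from bound[OF this] have "0 \<le> c * (?u \<bullet> ?u) - ?q ?u"
      by simp
    also have "?q ?u = c + 2 * t * ((W *v v) \<bullet> ?d) + t\<^sup>2 * ?q ?d"
      using inner_matrix_symmetric[OF sym, of v ?d]
      by (simp add: c_def matrix_vector_right_distrib matrix_vector_mult_scaleR inner_add_left
          inner_add_right power2_eq_square inner_commute algebra_simps)
    also have "c * (?u \<bullet> ?u) = c + 2 * t * ((c *\<^sub>R v) \<bullet> ?d) + c * t\<^sup>2 * (?d \<bullet> ?d)"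
      using vv by (simp add: inner_add_left inner_add_right power2_eq_square inner_commute
          algebra_simps)
    finally show "0 \<le> 2 * (?d \<bullet> ?d) * t + (c * (?d \<bullet> ?d) - ?q ?d) * t\<^sup>2"
      by (simp add: inner_diff_left algebra_simps)
  qed
  then have "W *v v = c *\<^sub>R v"
    by simp
  then show thesis
    using that vS nv bound by blast
qed

text \<open>Take an orthonormal set of eigenvectors of greatest cardinality. Were its orthogonal
  complement nonzero, this invariant subspace would contain a further unit eigenvector.\<close>

lemma symmetric_orthonormal_eigenbasis:
  fixes W :: "real ^ 'n ^ 'n"
  assumes sym: "transpose W = W"
  obtains B c where "finite B" "pairwise orthogonal B" "\<And>v. v \<in> B \<Longrightarrow> norm v = 1"
    "\<And>v. v \<in> B \<Longrightarrow> W *v v = c v *\<^sub>R v" "span B = UNIV"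
proof -
  define Q where "Q B \<longleftrightarrow> finite B \<and> pairwise orthogonal B \<and>
    (\<forall>v\<in>B. norm v = 1 \<and> (\<exists>c. W *v v = c *\<^sub>R v))" for B :: "(real ^ 'n) set"
  have card: "card B \<le> DIM(real ^ 'n)" if "Q B" for B
  proof -
    have "0 \<notin> B"
      using that by (auto simp: Q_def)
    then have "independent B"
      using that pairwise_orthogonal_independent by (auto simp: Q_def)
    then show ?thesis
      using independent_bound by blast
  qed
  have "Q {}"
    by (simp add: Q_def)
  moreover have "\<forall>B. Q B \<longrightarrow> card B < Suc (DIM(real ^ 'n))"
    using card by (simp add: less_Suc_eq_le)
  ultimately obtain B where B: "Q B" "\<And>B'. Q B' \<Longrightarrow> card B' \<le> card B"
    using ex_has_greatest_nat[of Q "{}" card "Suc (DIM(real ^ 'n))"] by blast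
  have "span B = UNIV"
  proof (rule ccontr)
    assume "span B \<noteq> UNIV"
    then have "span B \<subset> span UNIV"
      by auto
    then obtain w where w: "w \<noteq> 0" "\<And>y. y \<in> span B \<Longrightarrow> orthogonal w y"
      using orthogonal_to_subspace_exists_gen by metis
    let ?S = "{y. \<forall>v\<in>B. orthogonal v y}"
    have "w \<in> ?S"
      using w(2) span_base orthogonal_commute by blast
    have inv: "W *v u \<in> ?S" if u: "u \<in> ?S" for u
    proof (clarify)
      fix v assume v: "v \<in> B"
      then obtain c where "W *v v = c *\<^sub>R v"
        using B(1) by (auto simp: Q_def)
      then show "orthogonal v (W *v u)"
        using inner_matrix_symmetric[OF sym, of v u] u v by (simp add: orthogonal_def)
    qed
    have ne: "?S \<noteq> {0}"
      using \<open>w \<in> ?S\<close> w(1) by (metis singletonD)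
    obtain v c where v: "v \<in> ?S" "norm v = 1" "W *v v = c *\<^sub>R v"
      by (rule symmetric_Rayleigh_on_subspace[OF sym subspace_orthogonal_to_vectors ne inv])
    have "v \<notin> B"
      using v by (auto simp: orthogonal_def norm_eq_1)
    moreover have "Q (insert v B)"
      using B(1) v by (auto simp: Q_def pairwise_insert orthogonal_commute)
    ultimately show False
      using B(2)[of "insert v B"] B(1) by (simp add: Q_def)
  qed
  moreover obtain c where "\<And>v. v \<in> B \<Longrightarrow> W *v v = c v *\<^sub>R v"
    using B(1) unfolding Q_def by metis
  ultimately show thesis
    using B(1) by (intro that[of B c]) (auto simp: Q_def)
qed

text \<open>An eigenvector is non-orthogonal to some member of the eigenbasis, and by symmetry the
  two eigenvalues then agree. This makes the \<open>Max\<close> and \<open>Min\<close> in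
  \<open>lambda_max\<close> and \<open>lambda_min\<close> meaningful.\<close>

lemma finite_eigenvalues:
  fixes W :: "real ^ 'n ^ 'n"
  assumes sym: "transpose W = W"
  shows "finite (eigenvalues W)"
proof -
  obtain B c where fin: "finite B" and orth: "pairwise orthogonal B"
    and unit: "\<And>v. v \<in> B \<Longrightarrow> norm v = 1"
    and eig: "\<And>v. v \<in> B \<Longrightarrow> W *v v = c v *\<^sub>R v" and span: "span B = UNIV"
    by (rule symmetric_orthonormal_eigenbasis[OF sym]) blast
  note B = fin span eig
  have "eigenvalues W \<subseteq> c ` B"
  proof
    fix d assume "d \<in> eigenvalues W"
    then obtain u where u: "u \<noteq> 0" "W *v u = d *\<^sub>R u"
      by (auto simp: eigenvalues_def)
    have "\<exists>v\<in>B. v \<bullet> u \<noteq> 0"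
    proof (rule ccontr)
      assume "\<not> ?thesis"
      then have "orthogonal u u"
        using B(2) by (intro orthogonal_to_span[of u B]) (auto simp: orthogonal_def inner_commute)
      then show False
        using u(1) by (simp add: orthogonal_self)
    qed
    then obtain v where v: "v \<in> B" "v \<bullet> u \<noteq> 0"
      by blast
    have "d * (v \<bullet> u) = c v * (v \<bullet> u)"
      using inner_matrix_symmetric[OF sym, of v u] u(2) B(3)[OF v(1)] by simp
    then show "d \<in> c ` B"
      using v by auto
  qed
  then show ?thesis
    using B(1) finite_surj by blast
qed

lemma lambda_max_in_eigenvalues:
  fixes W :: "real ^ 'n ^ 'n"
  assumes sym: "transpose W = W"
  shows "lambda_max W \<in> eigenvalues W" and "u \<bullet> (W *v u) \<le> lambda_max W * (u \<bullet> u)"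
proof -
  have "(UNIV :: (real ^ 'n) set) \<noteq> {0}"
    by (metis UNIV_I singletonD zero_neq_one)
  then obtain v c where v: "norm v = 1" "W *v v = c *\<^sub>R v"
    and le: "\<And>u. u \<bullet> (W *v u) \<le> c * (u \<bullet> u)"
    using symmetric_Rayleigh_on_subspace[OF sym subspace_UNIV] by auto
  have c: "c \<in> eigenvalues W"
    using v by (auto simp: eigenvalues_def intro!: exI[of _ v])
  then show "lambda_max W \<in> eigenvalues W"
    unfolding lambda_max_def using finite_eigenvalues[OF sym] by (intro Max_in) auto
  have "c \<le> lambda_max W"
    unfolding lambda_max_def using finite_eigenvalues[OF sym] c by simp
  then show "u \<bullet> (W *v u) \<le> lambda_max W * (u \<bullet> u)"
    using le[of u] by (meson inner_ge_zero mult_right_mono order_trans)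
qed

section \<open>Positive semidefinite matrices and their square roots\<close>

lemma eigenvalue_nonneg:
  assumes "pos_semidef W" "c \<in> eigenvalues W"
  shows "0 \<le> c"
proof -
  obtain v where "v \<noteq> 0" "W *v v = c *\<^sub>R v"
    using assms(2) by (auto simp: eigenvalues_def)
  moreover have "0 \<le> v \<bullet> (W *v v)"
    using assms(1) by (simp add: pos_semidef_def)
  ultimately show ?thesis
    by (metis inner_scaleR_right inner_gt_zero_iff zero_le_mult_iff not_le)
qed

lemma pos_semidef_sqrt_exists:
  fixes W :: "real ^ 'n ^ 'n"
  assumes W: "pos_semidef W"
  shows "\<exists>S. pos_semidef S \<and> S ** S = W"
proof -
  have sym: "transpose W = W"
    using W by (simp add: pos_semidef_def)
  obtain B c where fin: "finite B" and orth: "pairwise orthogonal B"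
    and unit: "\<And>v. v \<in> B \<Longrightarrow> norm v = 1"
    and eig: "\<And>v. v \<in> B \<Longrightarrow> W *v v = c v *\<^sub>R v" and span: "span B = UNIV"
    by (rule symmetric_orthonormal_eigenbasis[OF sym]) blast
  have c0: "0 \<le> c v" if "v \<in> B" for v
    using eig[OF that] unit[OF that]
    by (intro eigenvalue_nonneg[OF W]) (auto simp: eigenvalues_def intro!: exI[of _ v])
  \<comment> \<open>The root is built spectrally: the coordinate along each eigenvector is scaled by
    the square root of its eigenvalue.\<close>
  define s where "s u = (\<Sum>v\<in>B. (sqrt (c v) * (v \<bullet> u)) *\<^sub>R v)" for u
  have "linear s"
    unfolding s_def by (intro linear_compose_sum ballI linearI) (simp_all add: inner_add_right algebra_simps)
  then have S: "matrix s *v u = s u" for u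
    by (simp add: matrix_works)
  have inner_s: "w \<bullet> s u = (\<Sum>v\<in>B. sqrt (c v) * (v \<bullet> w) * (v \<bullet> u))" for u w
    by (simp add: s_def inner_sum_right inner_commute mult_ac)
  have "transpose (matrix s) = matrix s"
    by (intro symmetric_matrixI) (simp add: S inner_s inner_commute[of "s _"] mult_ac)
  moreover have "0 \<le> u \<bullet> (matrix s *v u)" for u
    unfolding S inner_s using c0 by (intro sum_nonneg) (simp add: mult.assoc)
  moreover have "(matrix s ** matrix s) *v u = W *v u" for u
  proof -
    have vs: "v \<bullet> s u = sqrt (c v) * (v \<bullet> u)" if "v \<in> B" for v
    proof -
      have "v \<bullet> s u = (\<Sum>w\<in>B. if w = v then sqrt (c v) * (v \<bullet> u) else 0)"
        unfolding inner_s using that orth unit[OF that]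
        by (intro sum.cong refl) (auto simp: pairwise_def orthogonal_def norm_eq_1)
      then show ?thesis
        using that fin by simp
    qed
    have "(matrix s ** matrix s) *v u = s (s u)"
      by (simp add: S matrix_vector_mul_assoc[symmetric])
    also have "\<dots> = (\<Sum>v\<in>B. (c v * (v \<bullet> u)) *\<^sub>R v)"
      unfolding s_def[of "s u"] using vs c0 by (intro sum.cong refl) (simp add: mult.assoc[symmetric])
    also have "\<dots> = (\<Sum>v\<in>B. (u \<bullet> v) *\<^sub>R (W *v v))"
      using eig by (intro sum.cong refl) (simp add: inner_commute mult.commute)
    also have "\<dots> = W *v (\<Sum>v\<in>B. (u \<bullet> v) *\<^sub>R v)"
      by (simp add: linear_sum[OF matrix_vector_mul_linear] matrix_vector_mult_scaleR)
    also have "(\<Sum>v\<in>B. (u \<bullet> v) *\<^sub>R v) = u"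
      using orth unit span fin by (intro orthonormal_basis_expand) auto
    finally show ?thesis .
  qed
  ultimately show ?thesis
    unfolding pos_semidef_def by (metis matrix_eq)
qed

text \<open>The source of uniqueness of the root. Since (S + sqrt c)(S - sqrt c) v = 0, the residual
  (S - sqrt c) v would be an eigenvector of S for the negative value - sqrt c unless it is zero; for
  c = 0 the norm of S v vanishes directly.\<close>

lemma pos_semidef_sqrt_eigenvector:
  fixes S :: "real ^ 'n ^ 'n"
  assumes S: "pos_semidef S" and eig: "(S ** S) *v v = c *\<^sub>R v" and c: "0 \<le> c"
  shows "S *v v = sqrt c *\<^sub>R v"
proof (cases "c = 0")
  case True
  have "(S *v v) \<bullet> (S *v v) = v \<bullet> ((S ** S) *v v)"
    using S by (simp add: pos_semidef_def inner_matrix_symmetric matrix_vector_mul_assoc[symmetric])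
  then show ?thesis
    using True eig by simp
next
  case False
  let ?d = "S *v v - sqrt c *\<^sub>R v"
  have "S *v ?d = - (sqrt c *\<^sub>R ?d)"
    using eig c
    by (simp add: matrix_vector_mult_diff_distrib matrix_vector_mult_scaleR
        matrix_vector_mul_assoc scaleR_diff_right)
  moreover have "0 \<le> ?d \<bullet> (S *v ?d)"
    using S by (simp add: pos_semidef_def)
  ultimately have "sqrt c * (?d \<bullet> ?d) \<le> 0"
    by simp
  then have "?d \<bullet> ?d \<le> 0"
    using False c by (simp add: mult_le_0_iff)
  then show ?thesis
    by (metis eq_iff_diff_eq_0 inner_eq_zero_iff inner_ge_zero order_antisym)
qed

text \<open>Justifies the definite description: two roots act identically on an eigenbasis of
  \<open>W\<close>, hence everywhere.\<close>

lemma psd_sqrt: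
  fixes W :: "real ^ 'n ^ 'n"
  assumes W: "pos_semidef W"
  shows "pos_semidef (psd_sqrt W)" "psd_sqrt W ** psd_sqrt W = W"
proof -
  have sym: "transpose W = W"
    using W by (simp add: pos_semidef_def)
  obtain B c where fin: "finite B" and orth: "pairwise orthogonal B"
    and unit: "\<And>v. v \<in> B \<Longrightarrow> norm v = 1"
    and eig: "\<And>v. v \<in> B \<Longrightarrow> W *v v = c v *\<^sub>R v" and span: "span B = UNIV"
    by (rule symmetric_orthonormal_eigenbasis[OF sym]) blast
  have c0: "0 \<le> c v" if "v \<in> B" for v
    using eig[OF that] unit[OF that]
    by (intro eigenvalue_nonneg[OF W]) (auto simp: eigenvalues_def intro!: exI[of _ v])
  have "S = T" if "pos_semidef S \<and> S ** S = W" "pos_semidef T \<and> T ** T = W" for S T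
  proof -
    have "S *v v = T *v v" if "v \<in> B" for v
      using pos_semidef_sqrt_eigenvector c0 eig that \<open>pos_semidef S \<and> S ** S = W\<close>
        \<open>pos_semidef T \<and> T ** T = W\<close> by metis
    then have "S *v u = T *v u" for u
      using linear_eq_on_span[of "(*v) S" "(*v) T" B u] span by auto
    then show ?thesis
      by (simp add: matrix_eq)
  qed
  then have "\<exists>!S. pos_semidef S \<and> S ** S = W"
    using pos_semidef_sqrt_exists[OF W] by blast
  from theI'[OF this] show "pos_semidef (psd_sqrt W)" "psd_sqrt W ** psd_sqrt W = W"
    unfolding psd_sqrt_def by blast+
qed

lemma inner_psd_sqrt:
  fixes W :: "real ^ 'n ^ 'n"
  assumes W: "pos_semidef W"
  shows "(psd_sqrt W *v u) \<bullet> (psd_sqrt W *v v) = u \<bullet> (W *v v)"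
proof -
  let ?S = "psd_sqrt W"
  have "transpose ?S = ?S"
    using psd_sqrt(1)[OF W] by (simp only: pos_semidef_def)
  then have "(?S *v u) \<bullet> (?S *v v) = u \<bullet> (?S *v (?S *v v))"
    by (rule inner_matrix_symmetric[symmetric])
  also have "?S *v (?S *v v) = W *v v"
    by (simp only: matrix_vector_mul_assoc psd_sqrt(2)[OF W])
  finally show ?thesis .
qed

lemma norm_psd_sqrt_le:
  fixes W :: "real ^ 'n ^ 'n"
  assumes W: "pos_semidef W"
  shows "(norm (psd_sqrt W *v u))\<^sup>2 = u \<bullet> (W *v u)"
    and "(norm (psd_sqrt W *v u))\<^sup>2 \<le> lambda_max W * (norm u)\<^sup>2"
proof -
  show "(norm (psd_sqrt W *v u))\<^sup>2 = u \<bullet> (W *v u)"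
    by (simp only: power2_norm_eq_inner inner_psd_sqrt[OF W])
  then show "(norm (psd_sqrt W *v u))\<^sup>2 \<le> lambda_max W * (norm u)\<^sup>2"
    using lambda_max_in_eigenvalues(2)[of W u] W
    by (simp only: pos_semidef_def power2_norm_eq_inner)
qed

text \<open>The bound for the root, applied to the vector that the root itself produces from
  \<open>u\<close>.\<close>

lemma pos_semidef_norm_mult_le:
  fixes W :: "real ^ 'n ^ 'n"
  assumes W: "pos_semidef W"
  shows "(norm (W *v u))\<^sup>2 \<le> lambda_max W * (u \<bullet> (W *v u))"
  using norm_psd_sqrt_le(2)[OF W, of "psd_sqrt W *v u"]
  by (simp only: norm_psd_sqrt_le(1)[OF W] matrix_vector_mul_assoc psd_sqrt(2)[OF W])

text \<open>Cauchy-Schwarz for the semi-inner product of \<open>W\<close>, each factor being at most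
  the root of \<open>lambda_max W\<close> times the Euclidean norm.\<close>

lemma pos_semidef_inner_le:
  fixes W :: "real ^ 'n ^ 'n"
  assumes W: "pos_semidef W"
  shows "\<bar>u \<bullet> (W *v v)\<bar> \<le> lambda_max W * (norm u * norm v)"
proof -
  let ?S = "psd_sqrt W" and ?l = "lambda_max W"
  have l: "0 \<le> ?l"
    using W by (intro eigenvalue_nonneg[OF W] lambda_max_in_eigenvalues(1)) (simp add: pos_semidef_def)
  have *: "norm (?S *v w) \<le> sqrt ?l * norm w" for w
    using real_le_rsqrt[OF norm_psd_sqrt_le(2)[OF W, of w]] by (simp add: real_sqrt_mult)
  have "\<bar>u \<bullet> (W *v v)\<bar> \<le> norm (?S *v u) * norm (?S *v v)"
    unfolding inner_psd_sqrt[OF W, symmetric] by (rule Cauchy_Schwarz_ineq2)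
  also have "\<dots> \<le> (sqrt ?l * norm u) * (sqrt ?l * norm v)"
    using * l by (intro mult_mono) auto
  also have "\<dots> = ?l * (norm u * norm v)"
    using l by simp
  finally show ?thesis .
qed

section \<open>Inverses of positive definite matrices\<close>

lemma pos_def_imp_pos_semidef: "pos_def W \<Longrightarrow> pos_semidef W"
  unfolding pos_def_def pos_semidef_def by (metis inner_zero_left less_imp_le order_refl)

lemma pos_def_matrix_inv:
  fixes W :: "real ^ 'n ^ 'n"
  assumes W: "pos_def W"
  shows "W ** matrix_inv W = mat 1" "matrix_inv W ** W = mat 1"
    "transpose (matrix_inv W) = matrix_inv W"
proof -
  have "W *v u = 0 \<Longrightarrow> u = 0" for u
    using W unfolding pos_def_def by (metis inner_zero_right less_irrefl)
  then have "invertible W"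
    by (metis invertible_left_inverse matrix_left_invertible_ker)
  then have *: "W ** matrix_inv W = mat 1 \<and> matrix_inv W ** W = mat 1"
    unfolding invertible_def matrix_inv_def by (rule someI_ex)
  then show "W ** matrix_inv W = mat 1" "matrix_inv W ** W = mat 1"
    by auto
  have "transpose (matrix_inv W) = transpose (matrix_inv W) ** (W ** matrix_inv W)"
    by (simp add: *)
  also have "\<dots> = transpose (W ** matrix_inv W) ** matrix_inv W"
    using W by (simp add: matrix_transpose_mul pos_def_def matrix_mul_assoc)
  finally show "transpose (matrix_inv W) = matrix_inv W"
    by (simp add: *)
qed

text \<open>With u = W y, the second claim is the estimate of the squared norm of W y by
  \<open>lambda_max W\<close> times the form of \<open>W\<close> at y.\<close>

lemma matrix_inv_quadratic_ge:
  fixes W :: "real ^ 'n ^ 'n"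
  assumes W: "pos_def W"
  shows "0 < lambda_max W" "(norm u)\<^sup>2 / lambda_max W \<le> u \<bullet> (matrix_inv W *v u)"
proof -
  obtain v where v: "v \<noteq> 0" "W *v v = lambda_max W *\<^sub>R v"
    using lambda_max_in_eigenvalues(1)[of W] W by (auto simp: pos_def_def eigenvalues_def)
  have "0 < v \<bullet> (W *v v)"
    using W v(1) unfolding pos_def_def by blast
  then have "0 < lambda_max W * (v \<bullet> v)"
    by (simp add: v(2))
  then show pos: "0 < lambda_max W"
    using v(1) inner_gt_zero_iff zero_less_mult_pos2 by blast
  let ?y = "matrix_inv W *v u"
  have "W *v ?y = u"
    using pos_def_matrix_inv(1)[OF W] by (simp add: matrix_vector_mul_assoc)
  then have "(norm u)\<^sup>2 \<le> lambda_max W * (u \<bullet> ?y)"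
    using pos_semidef_norm_mult_le[OF pos_def_imp_pos_semidef[OF W], of ?y] by (simp add: inner_commute)
  then show "(norm u)\<^sup>2 / lambda_max W \<le> u \<bullet> ?y"
    using pos by (simp add: field_simps)
qed


section \<open>Convex functions\<close>

lemma subdifferential_monotone:
  assumes "v \<in> subdifferential h x" "w \<in> subdifferential h y"
  shows "0 \<le> (v - w) \<bullet> (x - y)"
proof -
  have fin: "\<bar>h x\<bar> \<noteq> \<infinity>" "\<bar>h y\<bar> \<noteq> \<infinity>"
    and le: "h x + ereal (v \<bullet> (y - x)) \<le> h y" "h y + ereal (w \<bullet> (x - y)) \<le> h x"
    using assms by (auto simp: subdifferential_def)
  obtain r s where rs: "h x = ereal r" "h y = ereal s"
    using fin by (metis ereal_infinity_cases abs_ereal.simps(2,3) ereal_cases)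
  have "r + v \<bullet> (y - x) \<le> s" "s + w \<bullet> (x - y) \<le> r"
    using le by (simp_all add: rs)
  then show ?thesis
    by (simp add: algebra_simps)
qed

text \<open>Fermat's rule for a convex plus a differentiable function. On the segment from u to y,
  minimality and convexity of \<open>h\<close> bound the difference quotients of \<open>q\<close>
  from below; the parameter then tends to 0 from the right.\<close>

lemma minimizer_subgradient:
  fixes h :: "real \<Rightarrow> ereal"
  assumes h: "proper h" "ereal_convex h"
    and q: "(q has_real_derivative d) (at u)"
    and min: "\<And>y. h u + ereal (q u) \<le> h y + ereal (q y)"
  shows "- d \<in> subdifferential h u"
proof -
  obtain y0 where y0: "h y0 \<noteq> \<infinity>" "\<And>y. h y \<noteq> -\<infinity>"
    using h(1) by (auto simp: proper_def)
  have "h u \<noteq> \<infinity>"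
    using min[of y0] y0 by (cases "h y0") auto
  with y0(2)[of u] obtain r where r: "h u = ereal r"
    by (cases "h u") auto
  have "h u + ereal (- d * (y - u)) \<le> h y" for y
  proof (cases "h y")
    case (real s)
    define \<phi> where "\<phi> t = q (u + t * (y - u))" for t
    have "(\<phi> has_real_derivative d * (y - u)) (at 0)"
    proof -
      have "((\<lambda>t. u + t * (y - u)) has_real_derivative (y - u)) (at 0)"
        by (auto intro!: derivative_eq_intros)
      then show ?thesis
        unfolding \<phi>_def using DERIV_chain2[of q d "\<lambda>t. u + t * (y - u)" 0] q by simp
    qed
    then have "((\<lambda>t. (\<phi> t - \<phi> 0) / t) \<longlongrightarrow> d * (y - u)) (at_right 0)"
      by (auto simp: has_field_derivative_iff intro: filterlim_mono[OF _ order_refl at_le])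
    moreover have "r - s \<le> (\<phi> t - \<phi> 0) / t" if t: "0 < t" "t < 1" for t
    proof -
      have "ereal (r + q u) \<le> h (u + t * (y - u)) + ereal (\<phi> t)"
        using min[of "u + t * (y - u)"] by (simp add: \<phi>_def r)
      also have "h (u + t * (y - u)) \<le> ereal ((1 - t) * r + t * s)"
        using h(2)[unfolded ereal_convex_def, rule_format, of t u y] t
        by (simp add: r real algebra_simps)
      finally have "ereal (r + q u) \<le> ereal ((1 - t) * r + t * s) + ereal (\<phi> t)"
        by (simp add: add_right_mono)
      then have "t * (r - s) \<le> \<phi> t - \<phi> 0"
        by (simp add: \<phi>_def algebra_simps)
      then show ?thesis
        using t by (simp add: field_simps)
    qed
    then have "\<forall>\<^sub>F t in at_right 0. r - s \<le> (\<phi> t - \<phi> 0) / t"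
      by (auto simp: eventually_at_right_field intro: exI[of _ 1])
    ultimately have "r - s \<le> d * (y - u)"
      by (intro tendsto_lowerbound) auto
    then show ?thesis
      by (simp add: r real)
  qed (use y0 in auto)
  then show ?thesis
    by (simp add: subdifferential_def r)
qed

text \<open>Sum of the descent inequality from x to p and the tangent inequalities at x towards q
  and at q towards p. It is applied with x the old iterate, where the gradient is taken, p the new
  iterate and q the optimum.\<close>

lemma smooth_convex_three_point:
  fixes f d :: "real \<Rightarrow> real"
  assumes cvx: "convex_on UNIV f"
    and d: "\<And>u. (f has_real_derivative d u) (at u)"
    and lip: "\<And>u v. \<bar>d u - d v\<bar> \<le> l * \<bar>u - v\<bar>"
  shows "- (l / 2 * (p - x)\<^sup>2) \<le> (p - q) * (d x - d q)"
proof -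
  have tangent: "d u * (v - u) \<le> f v - f u" for u v
    using convex_on_imp_above_tangent[OF cvx connected_UNIV, of u v "d u"] d by simp
  \<comment> \<open>The Lipschitz bound makes the derivative of this function nondecreasing; its
    tangent inequality at x is the descent lemma.\<close>
  let ?\<psi> = "\<lambda>t. l / 2 * t\<^sup>2 - f t"
  have \<psi>: "(?\<psi> has_real_derivative l * t - d t) (at t)" for t
    by (auto intro!: derivative_eq_intros d)
  have "convex_on UNIV ?\<psi>"
  proof (rule convex_on_realI[OF _ \<psi>])
    fix u v :: real assume "u \<le> v"
    then show "l * u - d u \<le> l * v - d v"
      using lip[of v u] by (simp add: algebra_simps)
  qed auto
  then have "(l * x - d x) * (p - x) \<le> ?\<psi> p - ?\<psi> x"
    using convex_on_imp_above_tangent[OF _ connected_UNIV, of ?\<psi> x p "l * x - d x"] \<psi> by simp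
  moreover have "l / 2 * p\<^sup>2 - l / 2 * x\<^sup>2 - l * x * (p - x) = l / 2 * (p - x)\<^sup>2"
    by (simp add: power2_eq_square field_simps)
  ultimately have "f p \<le> f x + d x * (p - x) + l / 2 * (p - x)\<^sup>2"
    by (simp add: algebra_simps)
  moreover have "f x + d x * (q - x) \<le> f q" "f q + d q * (p - q) \<le> f p"
    using tangent[of x q] tangent[of q p] by simp_all
  ultimately show ?thesis
    by (simp add: algebra_simps)
qed

text \<open>Moving only coordinate i in the subgradient inequality leaves a one-dimensional
  minimization, to which Fermat's rule applies.\<close>

lemma objective_subgradient_component:
  fixes f :: "'n::finite \<Rightarrow> real \<Rightarrow> real" and v x :: "real ^ 'n"
  assumes g: "\<And>i. proper (g i)" "\<And>i. ereal_convex (g i)"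
    and f: "\<And>i u. f i differentiable (at u)"
    and v: "v \<in> subdifferential (objective f g) x"
  shows "v $ i - deriv (f i) (x $ i) \<in> subdifferential (g i) (x $ i)"
proof -
  have nm: "g j u \<noteq> -\<infinity>" for j u
    using g(1) by (auto simp: proper_def)
  \<comment> \<open>Finiteness of the objective at \<open>x\<close> makes every \<open>g j\<close>
    finite there, so the terms of the other coordinates are real and cancel.\<close>
  have "(\<Sum>j\<in>UNIV. g j (x $ j)) \<noteq> \<infinity>"
    using v by (auto simp: subdifferential_def objective_def)
  then have "g j (x $ j) \<noteq> \<infinity>" for j
    by (auto simp: sum_Pinfty)
  then have "\<exists>r. g j (x $ j) = ereal r" for j
    using nm by (metis ereal_cases)
  then obtain r where r: "g j (x $ j) = ereal (r j)" for j
    by metis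
  have min: "g i (x $ i) + ereal (f i (x $ i) - v $ i * x $ i) \<le> g i w + ereal (f i w - v $ i * w)" for w
  proof (cases "g i w")
    case (real s)
    let ?y = "\<chi> j. if j = i then w else x $ j"
    let ?f = "\<Sum>j\<in>UNIV - {i}. f j (x $ j)" and ?r = "\<Sum>j\<in>UNIV - {i}. r j"
    have "(\<Sum>j\<in>UNIV. f j (?y $ j)) = f i w + ?f" "(\<Sum>j\<in>UNIV. f j (x $ j)) = f i (x $ i) + ?f"
      by (simp_all add: sum.remove[of UNIV i])
    moreover have "(\<Sum>j\<in>UNIV. g j (?y $ j)) = ereal (s + ?r)"
      "(\<Sum>j\<in>UNIV. g j (x $ j)) = ereal (r i + ?r)"
      by (simp_all add: sum.remove[of UNIV i] r real flip: plus_ereal.simps(1))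
    moreover have "v \<bullet> (?y - x) = v $ i * (w - x $ i)"
    proof -
      have "v \<bullet> (?y - x) = (\<Sum>j\<in>UNIV. if j = i then v $ i * (w - x $ i) else 0)"
        unfolding inner_vec_def by (intro sum.cong) auto
      then show ?thesis
        by simp
    qed
    moreover have "objective f g x + ereal (v \<bullet> (?y - x)) \<le> objective f g ?y"
      using v by (simp add: subdifferential_def)
    ultimately have "f i (x $ i) + ?f + (r i + ?r) + v $ i * (w - x $ i) \<le> f i w + ?f + (s + ?r)"
      by (simp only: objective_def plus_ereal.simps(1) ereal_less_eq)
    then show ?thesis
      by (simp add: r real algebra_simps)
  qed (use nm in auto)
  have "(f i has_real_derivative deriv (f i) (x $ i)) (at (x $ i))"
    using f by (simp add: DERIV_deriv_iff_real_differentiable)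
  then have "((\<lambda>w. f i w - v $ i * w) has_real_derivative deriv (f i) (x $ i) - v $ i) (at (x $ i))"
    by (auto intro!: derivative_eq_intros)
  from minimizer_subgradient[OF g(1,2) this min] show ?thesis
    by simp
qed


section \<open>The graph Laplacian\<close>

lemma laplacian_mult:
  fixes G :: "('n::finite \<times> 'n) set"
  shows "(laplacian G *v u) $ i = (\<Sum>j\<in>neighbors G i. u $ i - u $ j)"
proof -
  have "(laplacian G *v u) $ i = (\<Sum>j\<in>UNIV.
      (if i = j then real (card (neighbors G i)) * u $ j else 0) - (if j \<in> neighbors G i then u $ j else 0))"
    unfolding matrix_vector_mult_def vec_lambda_beta
    by (intro sum.cong)
      (auto simp: laplacian_def degree_matrix_def diag_matrix_def adjacency_matrix_def neighbors_def
        algebra_simps)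
  also have "\<dots> = real (card (neighbors G i)) * u $ i
      - (\<Sum>j\<in>UNIV. if j \<in> neighbors G i then u $ j else 0)"
    by (simp add: sum_subtractf)
  also have "(\<Sum>j\<in>UNIV. if j \<in> neighbors G i then u $ j else 0) = (\<Sum>j\<in>neighbors G i. u $ j)"
    by (simp add: sum.If_cases)
  finally show ?thesis
    by (simp add: sum_subtractf)
qed

lemma laplacian_mult_one: "laplacian G *v 1 = 0"
  by (simp add: vec_eq_iff laplacian_mult)

text \<open>The double sum meets every edge in both directions, hence the factor 1/2; the square
  appears on adding the sum to its copy with swapped indices.\<close>

lemma laplacian_quadratic_form:
  fixes G :: "('n::finite \<times> 'n) set"
  assumes "sym G"
  shows "u \<bullet> (laplacian G *v u) = (\<Sum>i\<in>UNIV. \<Sum>j\<in>neighbors G i. (u $ i - u $ j)\<^sup>2) / 2"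
proof -
  \<comment> \<open>Symmetric 0/1 weights extend the inner sums to all of \<open>UNIV\<close>, so
    that \<open>sum.swap\<close> applies.\<close>
  define w where "w i j = (if (i, j) \<in> G then 1 else 0 :: real)" for i j
  have N: "(\<Sum>j\<in>neighbors G i. h j) = (\<Sum>j\<in>UNIV. w i j * h j)" for i and h :: "'n \<Rightarrow> real"
    by (simp add: w_def neighbors_def sum.If_cases if_distrib[of "\<lambda>t. t * _"] cong: if_cong)
  have sym: "w i j = w j i" for i j
    using assms by (auto simp: w_def sym_def)
  have "u \<bullet> (laplacian G *v u) = (\<Sum>i\<in>UNIV. \<Sum>j\<in>UNIV. w i j * (u $ i * (u $ i - u $ j)))"
    (is "?q = _")
    by (simp add: inner_vec_def laplacian_mult N sum_distrib_left mult_ac)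
  moreover have "\<dots> = (\<Sum>i\<in>UNIV. \<Sum>j\<in>UNIV. w i j * (u $ j * (u $ j - u $ i)))"
    by (subst sum.swap) (simp add: sym)
  ultimately have "2 * ?q = (\<Sum>i\<in>UNIV. \<Sum>j\<in>UNIV. w i j * (u $ i * (u $ i - u $ j)))
      + (\<Sum>i\<in>UNIV. \<Sum>j\<in>UNIV. w i j * (u $ j * (u $ j - u $ i)))"
    by simp
  also have "\<dots> = (\<Sum>i\<in>UNIV. \<Sum>j\<in>UNIV. w i j * (u $ i - u $ j)\<^sup>2)"
    by (simp add: power2_eq_square algebra_simps flip: sum.distrib)
  finally show ?thesis
    by (simp add: N)
qed

lemma pos_semidef_laplacian:
  fixes G :: "('n::finite \<times> 'n) set"
  assumes "simple_graph G"
  shows "pos_semidef (laplacian G)"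
proof -
  have sym: "sym G"
    using assms by (simp add: simple_graph_def)
  have "transpose (laplacian G) = laplacian G"
    using sym by (auto simp: vec_eq_iff transpose_def laplacian_def degree_matrix_def diag_matrix_def
        adjacency_matrix_def sym_def)
  then show ?thesis
    unfolding pos_semidef_def laplacian_quadratic_form[OF sym] by (auto intro!: sum_nonneg)
qed

text \<open>A vanishing sum of squares forces equality across every edge, and paths carry it to all
  pairs of vertices.\<close>

lemma laplacian_form_zero_imp_const:
  fixes G :: "('n::finite \<times> 'n) set"
  assumes "sym G" "connected_graph G" and zero: "u \<bullet> (laplacian G *v u) = 0"
  shows "u $ i = u $ j"
proof -
  have "(\<Sum>i\<in>UNIV. \<Sum>j\<in>neighbors G i. (u $ i - u $ j)\<^sup>2) = 0"
    using zero laplacian_quadratic_form[OF assms(1)] by simp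
  then have edge: "u $ k = u $ l" if "(k, l) \<in> G" for k l
    using that by (auto simp: sum_nonneg_eq_0_iff sum_nonneg neighbors_def)
  have "(i, j) \<in> G\<^sup>*"
    using assms(2) by (simp add: connected_graph_def)
  then show ?thesis
    by (induction rule: rtrancl_induct) (auto dest: edge)
qed

section \<open>Averaging projection and shifted Laplacian\<close>

lemma avg_matrix_mult:
  fixes u :: "real ^ 'n"
  shows "avg_matrix *v u = ((1 \<bullet> u) / real CARD('n)) *\<^sub>R 1"
  by (simp add: vec_eq_iff avg_matrix_def matrix_vector_mult_def inner_vec_def sum_divide_distrib)

text \<open>The Laplacian form vanishes only on constant vectors, the averaging form only on vectors
  orthogonal to 1; these meet only in 0.\<close>

lemma pos_def_laplacian_avg:
  fixes G :: "('n::finite \<times> 'n) set"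
  assumes G: "simple_graph G" "connected_graph G" and \<beta>: "0 < \<beta>"
  shows "pos_def (\<beta> *\<^sub>R laplacian G + avg_matrix)" (is "pos_def ?W")
proof -
  have sym: "sym G"
    using G(1) by (simp add: simple_graph_def)
  note L = pos_semidef_laplacian[OF G(1), unfolded pos_semidef_def]
  have "transpose ?W = ?W"
    using L by (simp add: vec_eq_iff transpose_def avg_matrix_def)
  moreover have "0 < v \<bullet> (?W *v v)" if "v \<noteq> 0" for v
  proof (rule ccontr)
    assume "\<not> ?thesis"
    moreover have eq: "v \<bullet> (?W *v v) = \<beta> * (v \<bullet> (laplacian G *v v)) + (1 \<bullet> v)\<^sup>2 / real CARD('n)"
      by (simp add: matrix_vector_mult_add_rdistrib avg_matrix_mult inner_add_right power2_eq_square
          inner_commute flip: scaleR_matrix_vector_assoc)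
    moreover have "0 \<le> \<beta> * (v \<bullet> (laplacian G *v v))" "0 \<le> (1 \<bullet> v)\<^sup>2 / real CARD('n)"
      using L \<beta> by auto
    ultimately have "\<beta> * (v \<bullet> (laplacian G *v v)) = 0" "(1 \<bullet> v)\<^sup>2 / real CARD('n) = 0"
      by linarith+
    then have zero: "v \<bullet> (laplacian G *v v) = 0" "1 \<bullet> v = 0"
      using \<beta> by auto
    define c where "c = v $ undefined"
    have "v = c *\<^sub>R 1"
      using laplacian_form_zero_imp_const[OF sym G(2) zero(1)] by (simp add: vec_eq_iff c_def)
    moreover from this have "c = 0"
      using zero(2) by (simp add: inner_vec_def)
    ultimately show False
      using that by simp
  qed
  ultimately show ?thesis
    by (simp only: pos_def_def) simp
qed

text \<open>\<open>W\<close> fixes constant vectors and agrees with \<beta> L on their orthogonal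
  complement, so its inverse undoes \<beta> L up to the mean of \<open>u\<close>.\<close>

lemma matrix_inv_laplacian_avg_mult:
  fixes G :: "('n::finite \<times> 'n) set"
  assumes G: "simple_graph G" "connected_graph G" and \<beta>: "0 < \<beta>"
  defines "W \<equiv> \<beta> *\<^sub>R laplacian G + avg_matrix"
  shows "matrix_inv W *v (\<beta> *\<^sub>R (laplacian G *v u)) = u - avg_matrix *v u"
proof -
  have W: "pos_def W"
    unfolding W_def by (rule pos_def_laplacian_avg[OF G \<beta>])
  have cancel: "matrix_inv W *v (W *v v) = v" for v
    by (simp only: matrix_vector_mul_assoc pos_def_matrix_inv(2)[OF W] matrix_vector_mul_lid)
  have Wv: "W *v v = \<beta> *\<^sub>R (laplacian G *v v) + avg_matrix *v v" for v
    by (simp add: W_def matrix_vector_mult_add_rdistrib flip: scaleR_matrix_vector_assoc)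
  have "W *v (avg_matrix *v u) = avg_matrix *v u"
    by (simp add: Wv avg_matrix_mult matrix_vector_mult_scaleR laplacian_mult_one inner_vec_def)
  then have "\<beta> *\<^sub>R (laplacian G *v u) = W *v (u - avg_matrix *v u)"
    by (simp add: Wv matrix_vector_mult_diff_distrib)
  then show ?thesis
    by (simp only: cancel)
qed

lemma one_inner_laplacian:
  assumes "simple_graph G"
  shows "1 \<bullet> (laplacian G *v u) = 0"
  using inner_matrix_symmetric[of "laplacian G" 1 u] pos_semidef_laplacian[OF assms]
  by (simp add: pos_semidef_def laplacian_mult_one)

text \<open>The squared norm of the root applied to 1 is the Laplacian form at 1, which is 0;
  symmetry of the root then gives the claim.\<close>

lemma one_inner_sqrt_laplacian:
  assumes "simple_graph G"
  shows "1 \<bullet> (psd_sqrt (laplacian G) *v u) = 0"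
proof -
  note L = pos_semidef_laplacian[OF assms]
  have "(norm (psd_sqrt (laplacian G) *v 1))\<^sup>2 = 0"
    by (simp only: norm_psd_sqrt_le(1)[OF L] laplacian_mult_one inner_zero_right)
  moreover have "transpose (psd_sqrt (laplacian G)) = psd_sqrt (laplacian G)"
    using psd_sqrt(1)[OF L] by (simp only: pos_semidef_def)
  ultimately show ?thesis
    by (simp add: inner_matrix_symmetric)
qed


section \<open>Convergence\<close>

lemma diag_matrix_mult: "(diag_matrix d *v u) $ i = d $ i * u $ i"
  by (simp add: diag_matrix_def matrix_vector_mult_def if_distrib[of "\<lambda>t. t * _"] cong: if_cong)

lemma transpose_diag_matrix: "transpose (diag_matrix d) = diag_matrix d"
  by (auto simp: diag_matrix_def transpose_def vec_eq_iff)

lemma lambda_min_diag_matrix: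
  fixes d :: "real ^ 'n"
  shows "lambda_min (diag_matrix d) \<in> range (($) d)" and "lambda_min (diag_matrix d) \<le> d $ i"
proof -
  have ev: "d $ j \<in> eigenvalues (diag_matrix d)" for j
    by (auto simp: eigenvalues_def vec_eq_iff diag_matrix_mult axis_def intro!: exI[of _ "axis j 1"])
  have fin: "finite (eigenvalues (diag_matrix d))"
    by (rule finite_eigenvalues[OF transpose_diag_matrix])
  show "lambda_min (diag_matrix d) \<le> d $ i"
    unfolding lambda_min_def using fin ev by (rule Min_le)
  have "lambda_min (diag_matrix d) \<in> eigenvalues (diag_matrix d)"
    unfolding lambda_min_def using fin ev by (intro Min_in) auto
  then obtain v where "v \<noteq> 0" "diag_matrix d *v v = lambda_min (diag_matrix d) *\<^sub>R v"
    by (auto simp: eigenvalues_def)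
  then show "lambda_min (diag_matrix d) \<in> range (($) d)"
    by (auto simp: vec_eq_iff diag_matrix_mult) (metis rangeI)
qed

lemma lambda_min_diag_matrix_form:
  fixes d :: "real ^ 'n"
  shows "lambda_min (diag_matrix d) * (norm u)\<^sup>2 \<le> u \<bullet> (diag_matrix d *v u)"
proof -
  have "lambda_min (diag_matrix d) * (u $ i * u $ i) \<le> u $ i * (d $ i * u $ i)" for i
    using mult_right_mono[OF lambda_min_diag_matrix(2)[of d i], of "u $ i * u $ i"]
    by (simp add: mult_ac)
  then show ?thesis
    unfolding power2_norm_eq_inner inner_vec_def diag_matrix_mult sum_distrib_left inner_real_def
    by (intro sum_mono)
qed

text \<open>The polarization identity that makes the energy telescope.\<close>

lemma symmetric_form_difference:
  fixes M :: "real ^ 'n ^ 'n"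
  assumes "transpose M = M"
  shows "2 * (u \<bullet> (M *v (u - v))) = u \<bullet> (M *v u) - v \<bullet> (M *v v) + (u - v) \<bullet> (M *v (u - v))"
  using inner_matrix_symmetric[OF assms, of v u]
  by (simp add: matrix_vector_mult_diff_distrib inner_diff_left inner_diff_right inner_commute)

lemma norm_le_sqrt_card:
  fixes u :: "real ^ 'n"
  assumes "\<And>i. \<bar>u $ i\<bar> \<le> c"
  shows "norm u \<le> sqrt (real CARD('n)) * c"
proof -
  have c: "0 \<le> c"
    using assms[of undefined] by simp
  have "(\<Sum>i\<in>UNIV. (norm (u $ i))\<^sup>2) \<le> (\<Sum>i\<in>(UNIV::'n set). c\<^sup>2)"
    using assms by (intro sum_mono power_mono) auto
  then have "norm u \<le> sqrt (real CARD('n) * c\<^sup>2)"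
    unfolding norm_vec_def L2_set_def by (intro real_sqrt_le_mono) simp
  then show ?thesis
    using c by (simp add: real_sqrt_mult)
qed

text \<open>The maximum M of \<open>s\<close> over indices up to t satisfies M^2 \<le> C + S M with
  S the sum of the \<open>e j\<close>, and this forces M \<le> S + sqrt C.\<close>

lemma self_bounding_sequence:
  fixes s e :: "nat \<Rightarrow> real"
  assumes s: "\<And>k. 0 \<le> s k" and e: "\<And>k. 0 \<le> e k" and C: "0 \<le> C"
    and le: "\<And>k. (s k)\<^sup>2 \<le> C + (\<Sum>j=1..k. e j * s j)" and k: "k \<le> t"
  shows "s k \<le> (\<Sum>j=1..t. e j) + sqrt C"
proof -
  define M where "M = Max (s ` {..t})"
  let ?S = "\<Sum>j=1..t. e j"
  have M: "s j \<le> M" if "j \<le> t" for j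
    using that by (simp add: M_def)
  have "M \<in> s ` {..t}"
    unfolding M_def by (intro Max_in) auto
  then obtain m where m: "m \<le> t" "M = s m"
    by auto
  have "M\<^sup>2 \<le> C + (\<Sum>j=1..m. e j * s j)"
    using le m(2) by simp
  also have "(\<Sum>j=1..m. e j * s j) \<le> (\<Sum>j=1..t. e j * s j)"
    using m(1) s e by (intro sum_mono2) auto
  also have "\<dots> \<le> (\<Sum>j=1..t. e j * M)"
    using M e by (intro sum_mono mult_left_mono) auto
  finally have *: "M\<^sup>2 \<le> C + ?S * M"
    by (simp add: sum_distrib_right)
  have "M \<le> ?S + sqrt C"
  proof (rule ccontr)
    assume neg: "\<not> ?thesis"
    have "0 \<le> ?S"
      using e by (simp add: sum_nonneg)
    then have "sqrt C < M"
      using neg by linarith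
    \<comment> \<open>If M exceeded S + sqrt C, then C would be less than (M - S) M, against the
      quadratic inequality.\<close>
    have "C = sqrt C * sqrt C"
      using C by simp
    also have "\<dots> \<le> sqrt C * M"
      using \<open>sqrt C < M\<close> C by (intro mult_left_mono) auto
    also have "\<dots> < (M - ?S) * M"
      using neg \<open>sqrt C < M\<close> C real_sqrt_ge_zero[OF C] by (intro mult_strict_right_mono) linarith+
    finally show False
      using * by (simp add: power2_eq_square algebra_simps)
  qed
  then show ?thesis
    using M[OF k] by linarith
qed

theorem lemma4:
  fixes G :: "('n::finite \<times> 'n) set"
    and f :: "'n \<Rightarrow> real \<Rightarrow> real" and g :: "'n \<Rightarrow> real \<Rightarrow> ereal"
    and \<beta> :: real and \<eta> lf :: "real ^ 'n" and E :: "'n \<Rightarrow> nat \<Rightarrow> real"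
    and x xt z :: "nat \<Rightarrow> real ^ 'n" and xstar ystar zstar :: "real ^ 'n"
    and L H Lf P W :: "real ^ 'n ^ 'n" and Emax A :: "nat \<Rightarrow> real" and a b :: real
  assumes graph: "simple_graph G" "connected_graph G"
    and L: "L = laplacian G"
    and g: "\<And>i. proper (g i)" "\<And>i. lower_semicont (g i)" "\<And>i. ereal_convex (g i)"
    and beta: "\<beta> > 0"
    and H: "H = diag_matrix \<eta>" "pos_def H"
    and E_nonneg: "\<And>i k. E i k \<ge> 0"
    and Emax: "Emax = (\<lambda>k. Max (range (\<lambda>i. E i k)))" "decseq Emax" "summable Emax"
    and f_convex: "\<And>i. convex_on UNIV (f i)"
    and f_diff: "\<And>i u. f i differentiable (at u)"
    and lf_pos: "\<And>i. lf $ i > 0"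
    and f_lipschitz: "\<And>i u v. \<bar>deriv (f i) u - deriv (f i) v\<bar> \<le> lf $ i * \<bar>u - v\<bar>"
    and Lf: "Lf = diag_matrix lf"
    and P: "P = H - \<beta> *\<^sub>R L" "pos_def (P - Lf)"
    and run: "event_triggered_run G f g \<beta> \<eta> E x xt z"
    and opt: "optimal_pair G f g xstar ystar"
    and zstar: "zstar = psd_sqrt L *v ystar"
    and W: "W = \<beta> *\<^sub>R L + avg_matrix"
    and a: "a = max (2 * \<beta> * lambda_max L) 1"
    and b: "b = min (lambda_min Lf) (1 / lambda_max W)"
    and A: "A = (\<lambda>t. 2 * a * sqrt (real CARD('n)) / b * (\<Sum>k=1..t. Emax (k - 1)))"
  shows "\<forall>t\<ge>1. \<forall>k\<le>t.
    norm (x k - xstar) + norm (zstar - z k)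
      \<le> 2 * A t + sqrt (2 / b) * (wnorm P (x 0 - xstar) + wnorm (matrix_inv W) (z 0 - zstar))"
proof -
  let ?S = "psd_sqrt (laplacian G)" and ?n = "real CARD('n)"
  define D where "D k = x k - xstar" for k
  define R where "R k = z k - zstar" for k
  define \<xi> where "\<xi> k = xt k - x k" for k
  define M where "M = matrix_inv W"
  define V where "V k = D k \<bullet> (P *v D k) + R k \<bullet> (M *v R k)" for k
  define s where "s k = norm (D k) + norm (R k)" for k

  \<comment> \<open>Matrix bounds, optimality of the pair and the recursion\<close>
  note Lpsd = pos_semidef_laplacian[OF graph(1)]
  have Lsym: "transpose L = L"
    using Lpsd by (simp only: pos_semidef_def L)
  have W_pd: "pos_def W"
    unfolding W L by (rule pos_def_laplacian_avg[OF graph beta])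
  have Msym: "transpose M = M"
    unfolding M_def by (rule pos_def_matrix_inv(3)[OF W_pd])
  have M_ge: "(norm u)\<^sup>2 / lambda_max W \<le> u \<bullet> (M *v u)" for u
    unfolding M_def by (rule matrix_inv_quadratic_ge(2)[OF W_pd])
  have lW: "0 < lambda_max W"
    by (rule matrix_inv_quadratic_ge(1)[OF W_pd])
  have Psym: "transpose P = P"
    using Lsym transpose_diag_matrix[of \<eta>] by (simp add: P(1) H(1) vec_eq_iff transpose_def)
  have P_ge: "u \<bullet> (Lf *v u) \<le> u \<bullet> (P *v u)" for u
  proof -
    have "0 \<le> u \<bullet> ((P - Lf) *v u)"
      using pos_def_imp_pos_semidef[OF P(2)] unfolding pos_semidef_def by blast
    then show ?thesis
      by (simp add: matrix_vector_mult_diff_rdistrib inner_diff_right)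
  qed
  have Lf_ge: "lambda_min Lf * (norm u)\<^sup>2 \<le> u \<bullet> (Lf *v u)" for u
    unfolding Lf by (rule lambda_min_diag_matrix_form)
  have Lxstar: "L *v xstar = 0"
    using opt psd_sqrt(2)[OF Lpsd] unfolding L optimal_pair_def
    by (metis matrix_vector_mul_assoc matrix_vector_mult_0_right)

  have opt_sub: "- (zstar $ i) - deriv (f i) (xstar $ i) \<in> subdifferential (g i) (xstar $ i)" for i
  proof -
    obtain v where v: "v \<in> subdifferential (objective f g) xstar" "0 = v + ?S *v ystar"
      using opt unfolding optimal_pair_def by blast
    then have "v = - zstar"
      by (simp add: zstar L eq_neg_iff_add_eq_0)
    then show ?thesis
      using objective_subgradient_component[OF g(1,3) f_diff v(1), of i] by simp
  qed

  have z0: "z 0 = 0" and xt0: "xt 0 = x 0"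
    and argmin: "is_arg_min (\<lambda>u. g i u + ereal (\<eta> $ i / 2 * (u - x k $ i)\<^sup>2
        + (deriv (f i) (x k $ i) + z k $ i + \<beta> * (L *v xt k) $ i) * u)) (\<lambda>_. True) (x (Suc k) $ i)"
    and xt_Suc: "xt (Suc k) $ i =
        (if \<bar>x (Suc k) $ i - xt k $ i\<bar> > E i (Suc k) then x (Suc k) $ i else xt k $ i)"
    and z_Suc_nth: "z (Suc k) $ i = z k $ i + \<beta> * (L *v xt (Suc k)) $ i" for k i
    using run by (simp_all only: event_triggered_run_def L laplacian_mult)
  have z_Suc: "z (Suc k) = z k + \<beta> *\<^sub>R (L *v xt (Suc k))" for k
    by (simp add: vec_eq_iff z_Suc_nth)

  \<comment> \<open>\<open>z\<close> starts at 0 and moves within the range of \<open>L\<close>,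
    while \<open>zstar\<close> lies in the range of its root; both ranges are orthogonal to
    1.\<close>
  have one_R: "1 \<bullet> R k = 0" for k
  proof -
    have "1 \<bullet> z k = 0"
      by (induction k) (simp_all add: z0 z_Suc inner_add_right L one_inner_laplacian[OF graph(1)])
    then show ?thesis
      by (simp add: R_def inner_diff_right zstar L one_inner_sqrt_laplacian[OF graph(1)])
  qed

  \<comment> \<open>Size of the triggering errors\<close>
  have E_le: "E i k \<le> Emax k" for i k
    by (simp add: Emax(1))
  have Emax_nonneg: "0 \<le> Emax k" for k
    using E_nonneg E_le order_trans by blast
  have \<xi>_le: "norm (\<xi> k) \<le> sqrt ?n * Emax k" for k
  proof (rule norm_le_sqrt_card)
    fix i
    have "\<bar>\<xi> k $ i\<bar> \<le> E i k"
      \<comment> \<open>The error is zero at time 0 and after a broadcast; without a broadcast the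
        failed trigger test bounds it.\<close>
      using E_nonneg xt_Suc by (cases k) (auto simp: \<xi>_def xt0 abs_minus_commute not_less)
    then show "\<bar>\<xi> k $ i\<bar> \<le> Emax k"
      using E_le order_trans by blast
  qed
  \<comment> \<open>Monotone thresholds bound the new error by the old threshold as well, whence the
    index k - 1 in the sum of \<open>A\<close>.\<close>
  have \<xi>_Suc_le: "norm (\<xi> (Suc k)) \<le> sqrt ?n * Emax k" for k
    using \<xi>_le[of "Suc k"] Emax(2)[unfolded decseq_Suc_iff, rule_format, of k]
    by (meson mult_left_mono order_trans real_sqrt_ge_zero of_nat_0_le_iff)

  \<comment> \<open>Primal inequality from the minimization step\<close>
  have primal: "D (Suc k) \<bullet> (P *v (D (Suc k) - D k) + R (Suc k) + \<beta> *\<^sub>R (L *v (\<xi> k - \<xi> (Suc k))))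
      \<le> (D (Suc k) - D k) \<bullet> (Lf *v (D (Suc k) - D k)) / 2" for k
  proof -
    let ?\<Delta> = "D (Suc k) - D k"
    have \<Delta>: "?\<Delta> = x (Suc k) - x k"
      by (simp add: D_def)
    let ?v = "H *v ?\<Delta> + z k + \<beta> *\<^sub>R (L *v xt k) - zstar"
    have "D (Suc k) $ i * ?v $ i \<le> ?\<Delta> $ i * (Lf *v ?\<Delta>) $ i / 2" for i
    proof -
      let ?p = "x (Suc k) $ i" and ?u = "x k $ i" and ?q = "xstar $ i"
      let ?d = "deriv (f i)"
      define c where "c = ?d ?u + z k $ i + \<beta> * (L *v xt k) $ i"
      have "((\<lambda>u. \<eta> $ i / 2 * (u - ?u)\<^sup>2 + c * u) has_real_derivative \<eta> $ i * (?p - ?u) + c) (at ?p)"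
        by (auto intro!: derivative_eq_intros)
      moreover have "g i ?p + ereal (\<eta> $ i / 2 * (?p - ?u)\<^sup>2 + c * ?p)
          \<le> g i y + ereal (\<eta> $ i / 2 * (y - ?u)\<^sup>2 + c * y)" for y
        using argmin[of i k] by (simp add: is_arg_min_linorder c_def)
      ultimately have "- (\<eta> $ i * (?p - ?u) + c) \<in> subdifferential (g i) ?p"
        by (rule minimizer_subgradient[OF g(1,3)])
      \<comment> \<open>Monotonicity compares the new iterate with the optimum; the three-point
        inequality handles the gradient at the old iterate.\<close>
      from subdifferential_monotone[OF this opt_sub]
      have "0 \<le> (- (\<eta> $ i * (?p - ?u) + c) - (- (zstar $ i) - ?d ?q)) * (?p - ?q)"
        by simp
      moreover have "- (lf $ i / 2 * (?p - ?u)\<^sup>2) \<le> (?p - ?q) * (?d ?u - ?d ?q)"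
        using f_diff f_lipschitz
        by (intro smooth_convex_three_point[OF f_convex[of i]])
          (simp_all add: DERIV_deriv_iff_real_differentiable)
      ultimately have "(?p - ?q) * (\<eta> $ i * (?p - ?u) + z k $ i + \<beta> * (L *v xt k) $ i - zstar $ i)
          \<le> lf $ i / 2 * (?p - ?u)\<^sup>2"
        by (simp add: c_def algebra_simps)
      then show ?thesis
        unfolding \<Delta> by (simp add: D_def H(1) Lf diag_matrix_mult power2_eq_square mult_ac)
    qed
    then have "D (Suc k) \<bullet> ?v \<le> ?\<Delta> \<bullet> (Lf *v ?\<Delta>) / 2"
      unfolding inner_vec_def inner_real_def sum_divide_distrib by (intro sum_mono)
    \<comment> \<open>Replacing \<open>z k\<close> by \<open>z (Suc k)\<close> brings in
      \<open>xt k - xt (Suc k)\<close>, which is the change of \<xi> minus ?\<Delta>. The latter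
      part turns H into H - \<beta> L, the matrix \<open>P\<close>.\<close>
    moreover have "?v = P *v ?\<Delta> + R (Suc k) + \<beta> *\<^sub>R (L *v (\<xi> k - \<xi> (Suc k)))"
      by (simp add: P(1) R_def z_Suc \<Delta> \<xi>_def matrix_vector_mult_diff_rdistrib
          matrix_vector_mult_diff_distrib algebra_simps flip: scaleR_matrix_vector_assoc)
    ultimately show ?thesis
      by simp
  qed

  \<comment> \<open>Dual identity from the multiplier update\<close>
  have dual: "D (Suc k) \<bullet> R (Suc k) = R (Suc k) \<bullet> (M *v (R (Suc k) - R k)) - \<xi> (Suc k) \<bullet> R (Suc k)" for k
  proof -
    let ?u = "D (Suc k) + \<xi> (Suc k)"
    have "R (Suc k) - R k = \<beta> *\<^sub>R (laplacian G *v ?u)"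
      using Lxstar by (simp add: R_def z_Suc D_def \<xi>_def L matrix_vector_mult_diff_distrib)
    \<comment> \<open>The mean subtracted here disappears against \<open>R (Suc k)\<close>, which is
      orthogonal to 1.\<close>
    then have "M *v (R (Suc k) - R k) = ?u - avg_matrix *v ?u"
      by (simp only: M_def W L matrix_inv_laplacian_avg_mult[OF graph beta])
    then show ?thesis
      using one_R[of "Suc k"]
      by (simp add: avg_matrix_mult inner_diff_right inner_add_right inner_commute)
  qed

  \<comment> \<open>Energy estimate for one iteration\<close>
  have lL: "0 \<le> lambda_max L"
    unfolding L by (rule eigenvalue_nonneg[OF Lpsd lambda_max_in_eigenvalues(1)])
      (rule Lsym[unfolded L])
  have a_ge: "2 * \<beta> * lambda_max L \<le> a" "1 \<le> a"
    by (simp_all add: a)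

  have step: "V (Suc k) \<le> V k + 2 * a * sqrt ?n * Emax k * s (Suc k)" for k
  proof -
    let ?e = "sqrt ?n * Emax k" and ?D = "D (Suc k)" and ?R = "R (Suc k)"
    have e: "0 \<le> ?e"
      using Emax_nonneg by simp
    have "0 \<le> (?R - R k) \<bullet> (M *v (?R - R k))"
      using M_ge[of "?R - R k"] lW by (meson divide_nonneg_pos order_trans zero_le_power2)
    \<comment> \<open>In twice the primal inequality, polarization yields the energy difference and
      the \<open>P\<close>-form of the primal increment, which absorbs its \<open>Lf\<close>-form.
      The nonnegative \<open>M\<close>-form of the dual increment is dropped.\<close>
    moreover note P_ge[of "?D - D k"]
      symmetric_form_difference[OF Psym, of ?D "D k"] symmetric_form_difference[OF Msym, of ?R "R k"]
      primal[of k] dual[of k]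
    ultimately have "V (Suc k) - V k \<le> 2 * (\<xi> (Suc k) \<bullet> ?R - \<beta> * (?D \<bullet> (L *v (\<xi> k - \<xi> (Suc k)))))"
      by (simp add: V_def inner_add_right)
    \<comment> \<open>Here \<open>a\<close> only has to be at least 1. The primal term below uses
      its other lower bound, whose factor 2 pays for two triggering errors.\<close>
    moreover have "\<xi> (Suc k) \<bullet> ?R \<le> a * ?e * norm ?R"
    proof -
      have "\<xi> (Suc k) \<bullet> ?R \<le> norm (\<xi> (Suc k)) * norm ?R"
        by (rule norm_cauchy_schwarz)
      also have "\<dots> \<le> ?e * norm ?R"
        using \<xi>_Suc_le by (intro mult_right_mono) auto
      also have "\<dots> \<le> a * (?e * norm ?R)"
        using mult_right_mono[OF a_ge(2), of "?e * norm ?R"] e by simp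
      finally show ?thesis
        by (simp add: mult_ac)
    qed
    moreover have "- (\<beta> * (?D \<bullet> (L *v (\<xi> k - \<xi> (Suc k))))) \<le> a * ?e * norm ?D"
    proof -
      have "norm (\<xi> k - \<xi> (Suc k)) \<le> 2 * ?e"
        using norm_triangle_ineq4[of "\<xi> k" "\<xi> (Suc k)"] \<xi>_le[of k] \<xi>_Suc_le[of k] by linarith
      moreover have "- (?D \<bullet> (L *v (\<xi> k - \<xi> (Suc k))))
          \<le> lambda_max L * (norm ?D * norm (\<xi> k - \<xi> (Suc k)))"
        using pos_semidef_inner_le[OF Lpsd, of ?D "\<xi> k - \<xi> (Suc k)"] by (simp add: L)
      ultimately have "- (?D \<bullet> (L *v (\<xi> k - \<xi> (Suc k)))) \<le> lambda_max L * (norm ?D * (2 * ?e))"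
        using lL by (meson mult_left_mono norm_ge_zero order_trans)
      then have "\<beta> * - (?D \<bullet> (L *v (\<xi> k - \<xi> (Suc k)))) \<le> \<beta> * (lambda_max L * (norm ?D * (2 * ?e)))"
        using beta by (intro mult_left_mono) auto
      also have "\<dots> = (2 * \<beta> * lambda_max L) * (?e * norm ?D)"
        by (simp add: mult_ac)
      also have "\<dots> \<le> a * (?e * norm ?D)"
        using a_ge(1) e by (intro mult_right_mono) auto
      finally show ?thesis
        by (simp add: mult_ac)
    qed
    ultimately have "V (Suc k) - V k \<le> 2 * (a * ?e * norm ?R + a * ?e * norm ?D)"
      by argo
    then show ?thesis
      by (simp add: s_def algebra_simps)
  qed

  have V_le: "V k \<le> V 0 + (\<Sum>j=1..k. 2 * a * sqrt ?n * Emax (j - 1) * s j)" for k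
  proof (induction k)
    case (Suc k)
    then show ?case
      using step[of k] by simp
  qed simp

  \<comment> \<open>Coercivity of the energy and the final bound\<close>
  have b_pos: "0 < b"
    using lambda_min_diag_matrix(1)[of lf] lf_pos lW by (auto simp: b Lf)
  have DP: "b * (norm (D k))\<^sup>2 \<le> D k \<bullet> (P *v D k)" for k
  proof -
    have "b * (norm (D k))\<^sup>2 \<le> lambda_min Lf * (norm (D k))\<^sup>2"
      by (intro mult_right_mono) (auto simp: b)
    then show ?thesis
      using Lf_ge[of "D k"] P_ge[of "D k"] by linarith
  qed
  have RM: "b * (norm (R k))\<^sup>2 \<le> R k \<bullet> (M *v R k)" for k
  proof -
    have "b * (norm (R k))\<^sup>2 \<le> 1 / lambda_max W * (norm (R k))\<^sup>2"
      by (intro mult_right_mono) (auto simp: b)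
    then show ?thesis
      using M_ge[of "R k"] by simp
  qed
  have s_le: "(s k)\<^sup>2 \<le> 2 / b * V k" for k
  proof -
    \<comment> \<open>The square of a sum is at most twice the sum of squares; this is the 2 in 2 /
      b.\<close>
    have "(s k)\<^sup>2 \<le> 2 * ((norm (D k))\<^sup>2 + (norm (R k))\<^sup>2)"
      using sum_squares_ge_zero[of "norm (D k) - norm (R k)" 0]
      by (simp add: s_def power2_eq_square algebra_simps)
    moreover have "b * ((norm (D k))\<^sup>2 + (norm (R k))\<^sup>2) \<le> V k"
      using DP[of k] RM[of k] by (simp add: V_def algebra_simps)
    ultimately show ?thesis
      using b_pos mult_left_mono[of "(s k)\<^sup>2" _ b] by (fastforce simp: field_simps)
  qed

  have nonneg: "0 \<le> D 0 \<bullet> (P *v D 0)" "0 \<le> R 0 \<bullet> (M *v R 0)"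
    using DP[of 0] RM[of 0] b_pos by (meson less_imp_le mult_nonneg_nonneg order_trans zero_le_power2)+
  \<comment> \<open>The factor 2 / b times the coefficient 2 a sqrt n of the energy estimate, so
    that these terms sum to \<open>2 * A t\<close>.\<close>
  define e where "e j = 4 * a * sqrt ?n / b * Emax (j - 1)" for j
  have e: "0 \<le> e j" for j
    using a_ge(2) b_pos Emax_nonneg by (simp add: e_def)
  have rec: "(s k)\<^sup>2 \<le> 2 / b * V 0 + (\<Sum>j=1..k. e j * s j)" for k
  proof -
    have "(s k)\<^sup>2 \<le> 2 / b * (V 0 + (\<Sum>j=1..k. 2 * a * sqrt ?n * Emax (j - 1) * s j))"
      using s_le[of k] mult_left_mono[OF V_le[of k], of "2 / b"] b_pos by simp
    also have "\<dots> = 2 / b * V 0 + (\<Sum>j=1..k. e j * s j)"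
      by (simp add: distrib_left sum_distrib_left e_def mult_ac)
    finally show ?thesis .
  qed
  show ?thesis
  proof (intro allI impI)
    fix t k :: nat assume "1 \<le> t" "k \<le> t"
    have "s k \<le> (\<Sum>j=1..t. e j) + sqrt (2 / b * V 0)"
      using e rec \<open>k \<le> t\<close> nonneg b_pos
      by (intro self_bounding_sequence) (auto simp: s_def V_def)
    also have "(\<Sum>j=1..t. e j) = 2 * A t"
      by (simp add: e_def A sum_distrib_left sum_divide_distrib mult_ac)
    \<comment> \<open>Subadditivity of the square root splits the initial energy into the two
      weighted norms.\<close>
    also have "sqrt (2 / b * V 0) \<le> sqrt (2 / b) * (wnorm P (D 0) + wnorm M (R 0))"
      unfolding real_sqrt_mult V_def wnorm_def
      using sqrt_add_le_add_sqrt[OF nonneg] b_pos by (intro mult_left_mono) auto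
    finally show "norm (x k - xstar) + norm (zstar - z k)
      \<le> 2 * A t + sqrt (2 / b) * (wnorm P (x 0 - xstar) + wnorm (matrix_inv W) (z 0 - zstar))"
      by (simp add: s_def D_def R_def M_def norm_minus_commute)
  qed
qed

end
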